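(* There is an algorithm which, given any positive integers $k,n,m$ with $k\le n$ and any univariate functions $f_1,\dots,f_n:\{0,1,\dots,m\}\rightarrow\mathbb{R}$, finds, in time polynomial in $k,n,m$, a $k$-multihypergraph $H$ with $m$ edges on $[n]$ whose degree sequence $d=(d_1,\dots,d_n)=\sum H$ maximizes $\sum_{i=1}^n f_i(d_i)$ over all $k$-multihypergraphs with $m$ edges on $[n]$.
   Context: Let $[n]:=\{1,\dots,n\}$ and $\{0,1\}^n_k:=\{x\in\{0,1\}^n:\|x\|_1=k\}$, the set of $0$-$1$ vectors with exactly $k$ ones. A $k$-multihypergraph with $m$ edges on $[n]$ is a matrix $H=[H^1,\dots,H^m]\in\left(\{0,1\}^n_k\right)^m$, that is, an $n\times m$ matrix each of whose columns $H^j$ lies in $\{0,1\}^n_k$ and represents an edge; identical columns (multiple edges) are allowed. Its degree sequence is the vector $\sum H:=\sum_{j=1}^m H^j\in\mathbb{Z}_+^n$. The functions $f_i$ are arbitrary and are given by their values (each value $f_i(t)$ is available in unit time, and additions and comparisons of such values are counted as unit-time operations). *)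

theory Defs
  imports
    "HOL-Computational_Algebra.Polynomial"
    "Jordan_Normal_Form.Matrix"
begin

section \<open>Multihypergraphs\<close>

text \<open>
  Rows, columns and vertices are numbered from 0, as everywhere in the matrix library: vertex
  \<open>i\<close> here is vertex \<open>i + 1\<close> of \<open>{1,\<dots>,n}\<close>.
\<close>

definition zero_one_vecs :: "nat \<Rightarrow> nat \<Rightarrow> nat vec set" where
  "zero_one_vecs n k =
     {x \<in> carrier_vec n. (\<forall>i<n. x $ i \<in> {0, 1}) \<and> (\<Sum>i<n. x $ i) = k}"

definition multihypergraphs :: "nat \<Rightarrow> nat \<Rightarrow> nat \<Rightarrow> nat mat set" where
  "multihypergraphs k n m = {H \<in> carrier_mat n m. \<forall>j<m. col H j \<in> zero_one_vecs n k}"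

definition degree_sequence :: "nat mat \<Rightarrow> nat vec" where
  "degree_sequence H = vec (dim_row H) (\<lambda>i. \<Sum>j<dim_col H. col H j $ i)"

definition objective :: "nat \<Rightarrow> (nat \<Rightarrow> nat \<Rightarrow> real) \<Rightarrow> nat mat \<Rightarrow> real" where
  "objective n f H = (\<Sum>i<n. f i (degree_sequence H $ i))"


section \<open>The model of computation\<close>

text \<open>
  Algorithms are while programs on a random access machine with two kinds of memory: named arrays
  of natural numbers and named arrays of reals. Both are addressed by natural numbers; cell 0 of
  an array serves as a scalar variable. A program mentions only finitely many array names.

  Reals are opaque: a program can copy them, add two of them, compare two of them, and query the
  oracle for a value \<open>f\<^sub>i(t)\<close>. There are no real literals and no conversions between reals and
  naturals, except that the real cells initially hold 0.

  Every operation costs one unit. On natural numbers only addition, truncated subtraction and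
  comparison are provided. Without multiplication, \<open>t\<close> steps lengthen the binary
  representation of the numbers involved by only \<open>O(t)\<close> bits, so polynomial time under this
  unit cost measure agrees with polynomial time in the bit model.
\<close>

datatype iexp =
    IConst nat
  | ILoad string iexp
  | IAdd iexp iexp
  | ISub iexp iexp

datatype rexp =
    RLoad string iexp
  | RQuery iexp iexp
  | RAdd rexp rexp

datatype bexp =
    ILess iexp iexp
  | RLess rexp rexp
  | BNot bexp
  | BAnd bexp bexp

datatype com =
    Skip
  | IStore string iexp iexp
  | RStore string iexp rexp
  | Seq com com
  | Cond bexp com com
  | While bexp com

record state =
  imem :: "string \<Rightarrow> nat \<Rightarrow> nat"
  rmem :: "string \<Rightarrow> nat \<Rightarrow> real"

primrec ival :: "iexp \<Rightarrow> state \<Rightarrow> nat" where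
  "ival (IConst c) s = c"
| "ival (ILoad a e) s = imem s a (ival e s)"
| "ival (IAdd e1 e2) s = ival e1 s + ival e2 s"
| "ival (ISub e1 e2) s = ival e1 s - ival e2 s"

primrec rval :: "(nat \<Rightarrow> nat \<Rightarrow> real) \<Rightarrow> rexp \<Rightarrow> state \<Rightarrow> real" where
  "rval f (RLoad a e) s = rmem s a (ival e s)"
| "rval f (RQuery e1 e2) s = f (ival e1 s) (ival e2 s)"
| "rval f (RAdd r1 r2) s = rval f r1 s + rval f r2 s"

primrec bval :: "(nat \<Rightarrow> nat \<Rightarrow> real) \<Rightarrow> bexp \<Rightarrow> state \<Rightarrow> bool" where
  "bval f (ILess e1 e2) s \<longleftrightarrow> ival e1 s < ival e2 s"
| "bval f (RLess r1 r2) s \<longleftrightarrow> rval f r1 s < rval f r2 s"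
| "bval f (BNot b) s \<longleftrightarrow> \<not> bval f b s"
| "bval f (BAnd b1 b2) s \<longleftrightarrow> bval f b1 s \<and> bval f b2 s"

primrec icost :: "iexp \<Rightarrow> nat" where
  "icost (IConst c) = 1"
| "icost (ILoad a e) = 1 + icost e"
| "icost (IAdd e1 e2) = 1 + icost e1 + icost e2"
| "icost (ISub e1 e2) = 1 + icost e1 + icost e2"

primrec rcost :: "rexp \<Rightarrow> nat" where
  "rcost (RLoad a e) = 1 + icost e"
| "rcost (RQuery e1 e2) = 1 + icost e1 + icost e2"
| "rcost (RAdd r1 r2) = 1 + rcost r1 + rcost r2"

primrec bcost :: "bexp \<Rightarrow> nat" where
  "bcost (ILess e1 e2) = 1 + icost e1 + icost e2"
| "bcost (RLess r1 r2) = 1 + rcost r1 + rcost r2"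
| "bcost (BNot b) = 1 + bcost b"
| "bcost (BAnd b1 b2) = 1 + bcost b1 + bcost b2"

definition istore :: "string \<Rightarrow> nat \<Rightarrow> nat \<Rightarrow> state \<Rightarrow> state" where
  "istore a i v s = s\<lparr>imem := (imem s)(a := (imem s a)(i := v))\<rparr>"

definition rstore :: "string \<Rightarrow> nat \<Rightarrow> real \<Rightarrow> state \<Rightarrow> state" where
  "rstore a i v s = s\<lparr>rmem := (rmem s)(a := (rmem s a)(i := v))\<rparr>"

text \<open>
  \<open>exec f c s t s'\<close>: with oracle \<open>f\<close>, program \<open>c\<close> started in state \<open>s\<close> terminates in state
  \<open>s'\<close> after \<open>t\<close> time units.
\<close>

inductive exec :: "(nat \<Rightarrow> nat \<Rightarrow> real) \<Rightarrow> com \<Rightarrow> state \<Rightarrow> nat \<Rightarrow> state \<Rightarrow> bool"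
  for f :: "nat \<Rightarrow> nat \<Rightarrow> real" where
  Skip: "exec f Skip s 1 s"
| IStore: "exec f (IStore a e1 e2) s (1 + icost e1 + icost e2) (istore a (ival e1 s) (ival e2 s) s)"
| RStore: "exec f (RStore a e r) s (1 + icost e + rcost r) (rstore a (ival e s) (rval f r s) s)"
| Seq: "exec f c1 s1 t1 s2 \<Longrightarrow> exec f c2 s2 t2 s3 \<Longrightarrow> exec f (Seq c1 c2) s1 (t1 + t2) s3"
| CondTrue: "bval f b s \<Longrightarrow> exec f c1 s t s' \<Longrightarrow> exec f (Cond b c1 c2) s (1 + bcost b + t) s'"
| CondFalse: "\<not> bval f b s \<Longrightarrow> exec f c2 s t s' \<Longrightarrow> exec f (Cond b c1 c2) s (1 + bcost b + t) s'"
| WhileFalse: "\<not> bval f b s \<Longrightarrow> exec f (While b c) s (1 + bcost b) s"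
| WhileTrue: "bval f b s1 \<Longrightarrow> exec f c s1 t1 s2 \<Longrightarrow> exec f (While b c) s2 t2 s3 \<Longrightarrow>
    exec f (While b c) s1 (1 + bcost b + t1 + t2) s3"

inductive_cases SkipE: "exec f Skip s t s'"
inductive_cases IStoreE: "exec f (IStore a e1 e2) s t s'"
inductive_cases RStoreE: "exec f (RStore a e r) s t s'"
inductive_cases SeqE: "exec f (Seq c1 c2) s t s'"
inductive_cases CondE: "exec f (Cond b c1 c2) s t s'"
inductive_cases WhileE: "exec f (While b c) s t s'"

lemma exec_deterministic:
  "exec f c s t s' \<Longrightarrow> exec f c s u s'' \<Longrightarrow> t = u \<and> s' = s''"
proof (induction arbitrary: u s'' rule: exec.induct)
  case (Skip s)
  then show ?case by (rule SkipE) simp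
next
  case (IStore a e1 e2 s)
  then show ?case by (rule IStoreE) simp
next
  case (RStore a e r s)
  then show ?case by (rule RStoreE) simp
next
  case (Seq c1 s1 t1 s2 c2 t2 s3)
  from Seq.prems show ?case
  proof (rule SeqE)
    fix u1 r u2
    assume u: "u = u1 + u2" "exec f c1 s1 u1 r" "exec f c2 r u2 s''"
    from Seq.IH(1)[OF u(2)] have 1: "t1 = u1" "s2 = r" by simp_all
    from Seq.IH(2)[unfolded 1(2), OF u(3)] show ?thesis by (simp add: u(1) 1)
  qed
next
  case (CondTrue b s c1 t s' c2)
  from CondTrue.prems show ?case
  proof (rule CondE)
    fix u' assume u: "u = Suc (bcost b + u')" "exec f c1 s u' s''"
    from CondTrue.IH[OF u(2)] show ?thesis by (simp add: u(1))
  qed (simp_all add: CondTrue.hyps)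
next
  case (CondFalse b s c2 t s' c1)
  from CondFalse.prems show ?case
  proof (rule CondE)
    fix u' assume u: "u = Suc (bcost b + u')" "exec f c2 s u' s''"
    from CondFalse.IH[OF u(2)] show ?thesis by (simp add: u(1))
  qed (simp_all add: CondFalse.hyps)
next
  case (WhileFalse b s c)
  from WhileFalse.prems show ?case by (rule WhileE) (simp_all add: WhileFalse.hyps)
next
  case (WhileTrue b s1 c t1 s2 t2 s3)
  from WhileTrue.prems show ?case
  proof (rule WhileE)
    fix u1 r u2
    assume u: "u = Suc (bcost b + u1 + u2)" "exec f c s1 u1 r" "exec f (While b c) r u2 s''"
    from WhileTrue.IH(1)[OF u(2)] have 1: "t1 = u1" "s2 = r" by simp_all
    from WhileTrue.IH(2)[unfolded 1(2), OF u(3)] show ?thesis by (simp add: u(1) 1)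
  qed (simp_all add: WhileTrue.hyps)
qed

text \<open>
  The parameters \<open>k\<close>, \<open>n\<close>, \<open>m\<close> are passed in cell 0 of the arrays of that name; all other cells
  are 0.  The functions \<open>f\<^sub>i\<close> are accessible only through the oracle. The resulting matrix is read
  off row by row from the array \<open>H\<close>.
\<close>

definition input_state :: "nat \<Rightarrow> nat \<Rightarrow> nat \<Rightarrow> state" where
  "input_state k n m = istore ''k'' 0 k (istore ''n'' 0 n (istore ''m'' 0 m
     \<lparr>imem = (\<lambda>_ _. 0), rmem = (\<lambda>_ _. 0)\<rparr>))"

definition output_matrix :: "nat \<Rightarrow> nat \<Rightarrow> state \<Rightarrow> nat mat" where
  "output_matrix n m s = mat n m (\<lambda>(i, j). imem s ''H'' (i * m + j))"

text \<open>The value \<open>p(k,n,m)\<close> of a polynomial in three variables.\<close>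

definition poly3 :: "nat poly poly poly \<Rightarrow> nat \<Rightarrow> nat \<Rightarrow> nat \<Rightarrow> nat" where
  "poly3 p k n m = poly (poly (poly p [:[:k:]:]) [:n:]) m"

end

theory Submission
  imports Defs
begin

text \<open>
  Each edge contains a vertex at most once, so the degrees of a \<open>k\<close>-multihypergraph with \<open>m\<close>
  edges are at most \<open>m\<close>, and they add up to \<open>k m\<close>. These two conditions already characterise the
  degree sequences: write down \<open>d\<^sub>0\<close> copies of vertex 0, then \<open>d\<^sub>1\<close> copies of vertex 1, and so on,
  and deal this list of \<open>k m\<close> entries out cyclically, entry \<open>q\<close> going to edge \<open>q mod m\<close>. Every edge
  receives \<open>k\<close> entries, and they are distinct because the copies of a vertex occupy at most \<open>m\<close>
  consecutive positions (\<open>cyclic_matrix\<close>).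

  What remains is to maximise \<open>f\<^sub>0(d\<^sub>0) + \<dots>\<close> over integers \<open>0 \<le> d\<^sub>i \<le> m\<close> with sum \<open>k m\<close>. The objective
  is separable, so the best value for the first \<open>i\<close> vertices subject to a prescribed sum \<open>s\<close>
  satisfies a Bellman recursion in \<open>i\<close>. Its table has \<open>(n + 1)(k m + 1)\<close> cells, each filled by
  comparing at most \<open>m + 1\<close> candidates. A table that satisfies the recursion bounds the objective of
  every admissible sequence (\<open>dp_table_upper_bound\<close>), and following the recorded choices backwards
  yields a sequence that reaches the bound (\<open>dp_table_attained\<close>).

  The program fills this table and then traces the optimal choices back from the last vertex to the
  first, dealing the copies of each vertex out as soon as its degree is known. Tracing back visits
  the prefix sums in descending order, so the positions \<open>q\<close> are visited in descending order as well,
  and \<open>q mod m\<close> is maintained by counting down cyclically. Since the machine has no multiplication,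
  the products \<open>i m\<close> and \<open>i (k m + 1)\<close> needed to address rows are maintained by repeated addition
  and subtraction in the same manner.
\<close>

section \<open>Reasoning about running times\<close>

text \<open>
  A total correctness triple that also bounds the running time. It is stated for a single start
  state, so that initial values can be mentioned in the postcondition without ghost variables.
\<close>

definition runs :: "(nat \<Rightarrow> nat \<Rightarrow> real) \<Rightarrow> com \<Rightarrow> state \<Rightarrow> nat \<Rightarrow> (state \<Rightarrow> bool) \<Rightarrow> bool" where
  "runs f c s B Q \<longleftrightarrow> (\<exists>t s'. exec f c s t s' \<and> t \<le> B \<and> Q s')"

lemma runs_mono:
  "runs f c s B Q \<Longrightarrow> B \<le> B' \<Longrightarrow> (\<And>s'. Q s' \<Longrightarrow> Q' s') \<Longrightarrow> runs f c s B' Q'"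
  unfolding runs_def by (meson order_trans)

lemma runs_Seq:
  assumes "runs f c1 s B1 Q" "\<And>s'. Q s' \<Longrightarrow> runs f c2 s' B2 R"
  shows "runs f (Seq c1 c2) s (B1 + B2) R"
  using assms unfolding runs_def by (meson add_mono exec.Seq)

text \<open>
  The number \<open>N\<close> of iterations is part of the rule and the invariant is indexed by the number of
  completed ones. Hence no separate variant is needed, and the time bound is a product.
\<close>

lemma runs_While:
  assumes "I 0 s"
    and step: "\<And>j s. j < N \<Longrightarrow> I j s \<Longrightarrow> bval f b s \<and> runs f c s B (I (Suc j))"
    and stop: "\<And>s. I N s \<Longrightarrow> \<not> bval f b s"
  shows "runs f (While b c) s (N * (1 + bcost b + B) + (1 + bcost b)) (I N)"
proof -
  have "runs f (While b c) s (r * (1 + bcost b + B) + (1 + bcost b)) (I N)"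
    if "r \<le> N" "I (N - r) s" for r s
    using that
  proof (induction r arbitrary: s)
    case 0
    then show ?case
      using exec.WhileFalse[OF stop] unfolding runs_def by fastforce
  next
    case (Suc r)
    from step[of "N - Suc r" s] Suc.prems
    have b: "bval f b s" and c: "runs f c s B (I (N - r))"
      by (simp_all add: Suc_diff_Suc)
    from c obtain t1 s1 where 1: "exec f c s t1 s1" "t1 \<le> B" "I (N - r) s1"
      unfolding runs_def by blast
    from Suc.IH[OF _ 1(3)] Suc.prems(1) obtain t2 s2 where 2: "exec f (While b c) s1 t2 s2"
      "t2 \<le> r * (1 + bcost b + B) + (1 + bcost b)" "I N s2"
      unfolding runs_def by auto
    from exec.WhileTrue[OF b 1(1) 2(1)] 1(2) 2(2,3) show ?case
      unfolding runs_def by (intro exI conjI) auto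
  qed
  from this[of N s] assms(1) show ?thesis by simp
qed

text \<open>
  On programs without loops, execution is the function \<open>run\<close>, and the time is at most \<open>worst_cost\<close>,
  which does not depend on the state. Verifying such a program thus amounts to rewriting.
\<close>

primrec loop_free :: "com \<Rightarrow> bool" where
  "loop_free Skip = True"
| "loop_free (IStore a e1 e2) = True"
| "loop_free (RStore a e r) = True"
| "loop_free (Seq c1 c2) = (loop_free c1 \<and> loop_free c2)"
| "loop_free (Cond b c1 c2) = (loop_free c1 \<and> loop_free c2)"
| "loop_free (While b c) = False"

primrec run :: "(nat \<Rightarrow> nat \<Rightarrow> real) \<Rightarrow> com \<Rightarrow> state \<Rightarrow> state" where
  "run f Skip s = s"
| "run f (IStore a e1 e2) s = istore a (ival e1 s) (ival e2 s) s"
| "run f (RStore a e r) s = rstore a (ival e s) (rval f r s) s"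
| "run f (Seq c1 c2) s = run f c2 (run f c1 s)"
| "run f (Cond b c1 c2) s = (if bval f b s then run f c1 s else run f c2 s)"
| "run f (While b c) s = s"

primrec worst_cost :: "com \<Rightarrow> nat" where
  "worst_cost Skip = 1"
| "worst_cost (IStore a e1 e2) = 1 + icost e1 + icost e2"
| "worst_cost (RStore a e r) = 1 + icost e + rcost r"
| "worst_cost (Seq c1 c2) = worst_cost c1 + worst_cost c2"
| "worst_cost (Cond b c1 c2) = 1 + bcost b + max (worst_cost c1) (worst_cost c2)"
| "worst_cost (While b c) = 0"

lemma exec_run: "loop_free c \<Longrightarrow> \<exists>t. exec f c s t (run f c s) \<and> t \<le> worst_cost c"
proof (induction c arbitrary: s)
  case (Seq c1 c2)
  then obtain t1 t2 where "exec f c1 s t1 (run f c1 s)" "t1 \<le> worst_cost c1"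
    "exec f c2 (run f c1 s) t2 (run f c2 (run f c1 s))" "t2 \<le> worst_cost c2"
    by (metis loop_free.simps(4))
  then show ?case by (auto intro!: exI[of _ "t1 + t2"] exec.Seq)
next
  case (Cond b c1 c2)
  show ?case
  proof (cases "bval f b s")
    case True
    obtain t where "exec f c1 s t (run f c1 s)" "t \<le> worst_cost c1"
      using Cond by (metis loop_free.simps(5))
    with True exec.CondTrue[OF True this(1)] show ?thesis by fastforce
  next
    case False
    obtain t where "exec f c2 s t (run f c2 s)" "t \<le> worst_cost c2"
      using Cond by (metis loop_free.simps(5))
    with False exec.CondFalse[OF False this(1)] show ?thesis by fastforce
  qed
qed (auto intro: exec.intros exI)

lemma runs_loop_free:
  "loop_free c \<Longrightarrow> worst_cost c \<le> B \<Longrightarrow> Q (run f c s) \<Longrightarrow> runs f c s B Q"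
  unfolding runs_def using exec_run order_trans by blast

lemma store_simps [simp]:
  "imem (istore a i v s) = (imem s)(a := (imem s a)(i := v))"
  "rmem (istore a i v s) = rmem s"
  "imem (rstore a i x s) = imem s"
  "rmem (rstore a i x s) = (rmem s)(a := (rmem s a)(i := x))"
  by (simp_all add: istore_def rstore_def)

abbreviation reg :: "string \<Rightarrow> iexp" where
  "reg x \<equiv> ILoad x (IConst 0)"

abbreviation set_reg :: "string \<Rightarrow> iexp \<Rightarrow> com" where
  "set_reg x e \<equiv> IStore x (IConst 0) e"


section \<open>Degree sequences of multihypergraphs\<close>

lemma degree_sequence_index:
  "H \<in> carrier_mat n m \<Longrightarrow> i < n \<Longrightarrow> degree_sequence H $ i = (\<Sum>j<m. H $$ (i, j))"
  by (auto simp: degree_sequence_def intro!: sum.cong)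

lemma multihypergraphs_iff:
  "H \<in> multihypergraphs k n m \<longleftrightarrow> H \<in> carrier_mat n m \<and>
    (\<forall>j<m. (\<forall>i<n. H $$ (i, j) \<in> {0, 1}) \<and> (\<Sum>i<n. H $$ (i, j)) = k)"
  unfolding multihypergraphs_def zero_one_vecs_def by (auto; metis One_nat_def)

lemma degree_le:
  assumes "H \<in> multihypergraphs k n m" "i < n"
  shows "degree_sequence H $ i \<le> m"
proof -
  have H: "H \<in> carrier_mat n m" "\<And>j. j < m \<Longrightarrow> H $$ (i, j) \<le> 1"
    using assms by (fastforce simp: multihypergraphs_iff)+
  have "(\<Sum>j<m. H $$ (i, j)) \<le> (\<Sum>j<m. 1)"
    by (rule sum_mono) (use H in auto)
  then show ?thesis using H assms(2) by (simp add: degree_sequence_index)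
qed

lemma sum_degrees:
  assumes "H \<in> multihypergraphs k n m"
  shows "(\<Sum>i<n. degree_sequence H $ i) = k * m"
proof -
  have "(\<Sum>i<n. degree_sequence H $ i) = (\<Sum>i<n. \<Sum>j<m. H $$ (i, j))"
    using assms by (auto simp: multihypergraphs_iff degree_sequence_index intro!: sum.cong)
  also have "\<dots> = (\<Sum>j<m. \<Sum>i<n. H $$ (i, j))" by (rule sum.swap)
  also have "\<dots> = (\<Sum>j<m. k)"
    using assms by (intro sum.cong) (auto simp: multihypergraphs_iff)
  finally show ?thesis by simp
qed

abbreviation prefix_sum :: "(nat \<Rightarrow> nat) \<Rightarrow> nat \<Rightarrow> nat" where
  "prefix_sum d i \<equiv> (\<Sum>j<i. d j)"

lemma prefix_sum_mono: "i \<le> j \<Longrightarrow> prefix_sum d i \<le> prefix_sum d j"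
  by (rule sum_mono2) auto

text \<open>
  The edges that receive vertex \<open>i\<close> when the list with \<open>d j\<close> consecutive copies of each vertex \<open>j\<close>
  is dealt out cyclically to \<open>m\<close> edges.
\<close>

definition cyclic_edges :: "(nat \<Rightarrow> nat) \<Rightarrow> nat \<Rightarrow> nat \<Rightarrow> nat set" where
  "cyclic_edges d m i = (\<lambda>q. q mod m) ` {prefix_sum d i..<prefix_sum d (Suc i)}"

text \<open>
  This is the place where the bound \<open>m\<close> on the degrees matters: at most \<open>m\<close> consecutive positions
  never meet the same edge twice.
\<close>

lemma inj_on_mod_interval:
  assumes "b \<le> a + m"
  shows "inj_on (\<lambda>q. q mod m) {a..<b :: nat}"
proof (rule inj_onI)
  have *: "x = y" if "x \<le> y" "a \<le> x" "y < b" "x mod m = y mod m" for x y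
  proof -
    have "m dvd y - x" using that mod_eq_dvd_iff_nat[of x y m] by simp
    moreover have "y - x < m" using that assms by linarith
    ultimately have "y - x = 0" by (metis dvd_imp_le not_gr0 not_le)
    then show "x = y" using that by simp
  qed
  show "x = y" if "x \<in> {a..<b}" "y \<in> {a..<b}" "x mod m = y mod m" for x y
    using *[of x y] *[of y x] that by (metis atLeastLessThan_iff nat_le_linear)
qed

lemma card_residue_class:
  assumes "j < m"
  shows "card {q. q < k * m \<and> q mod m = j} = (k :: nat)"
proof -
  have "{q. q < k * m \<and> q mod m = j} = (\<lambda>l. l * m + j) ` {..<k}" (is "?A = ?B")
  proof
    show "?A \<subseteq> ?B"
    proof
      fix q assume "q \<in> ?A"
      then have "q = q div m * m + j" "q div m < k"
        by (auto simp: less_mult_imp_div_less)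
      then show "q \<in> ?B" by blast
    qed
    show "?B \<subseteq> ?A"
    proof
      fix q assume "q \<in> ?B"
      then obtain l where l: "q = l * m + j" "l < k" by auto
      have "Suc l * m \<le> k * m" using l by (intro mult_le_mono1) simp
      then show "q \<in> ?A" using l assms by simp
    qed
  qed
  moreover have "inj_on (\<lambda>l. l * m + j) {..<k}" using assms by (auto intro!: inj_onI)
  ultimately show ?thesis by (simp add: card_image)
qed

text \<open>
  The blocks of the vertices partition the positions, so the entries of a column of the matrix
  can be counted by positions instead of vertices.
\<close>

lemma sum_card_consecutive:
  "(\<Sum>i<n. card {q \<in> {prefix_sum d i..<prefix_sum d (Suc i)}. P q}) =
    card {q. q < prefix_sum d n \<and> P q}"
proof (induction n)
  case (Suc n)
  have "{q. q < prefix_sum d (Suc n) \<and> P q} =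
      {q. q < prefix_sum d n \<and> P q} \<union> {q \<in> {prefix_sum d n..<prefix_sum d (Suc n)}. P q}"
    by auto
  moreover have "card \<dots> = card {q. q < prefix_sum d n \<and> P q} +
      card {q \<in> {prefix_sum d n..<prefix_sum d (Suc n)}. P q}"
    by (rule card_Un_disjoint) auto
  ultimately show ?case using Suc by simp
qed simp

text \<open>
  Column \<open>j\<close> has sum \<open>k\<close> since exactly \<open>k\<close> of the \<open>k m\<close> positions are congruent to \<open>j\<close> modulo \<open>m\<close>;
  row \<open>i\<close> has sum \<open>d i\<close> since the \<open>d i\<close> positions of vertex \<open>i\<close> go to different edges.
\<close>

lemma cyclic_matrix:
  assumes "0 < m" and d: "\<And>i. i < n \<Longrightarrow> d i \<le> m" and "prefix_sum d n = k * m"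
    and H: "H = mat n m (\<lambda>(i, j). of_bool (j \<in> cyclic_edges d m i))"
  shows "H \<in> multihypergraphs k n m"
    and "\<And>i. i < n \<Longrightarrow> degree_sequence H $ i = d i"
proof -
  have inj: "inj_on (\<lambda>q. q mod m) {prefix_sum d i..<prefix_sum d (Suc i)}" if "i < n" for i
    using d[OF that] by (intro inj_on_mod_interval) simp
  have carrier: "H \<in> carrier_mat n m" by (simp add: H)
  have "(\<Sum>i<n. H $$ (i, j)) = k" if "j < m" for j
  proof -
    have "H $$ (i, j) = card {q \<in> {prefix_sum d i..<prefix_sum d (Suc i)}. q mod m = j}"
      if "i < n" for i
    proof (cases "j \<in> cyclic_edges d m i")
      case True
      then obtain q where q: "q \<in> {prefix_sum d i..<prefix_sum d (Suc i)}" "q mod m = j"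
        by (auto simp: cyclic_edges_def)
      then have "{q \<in> {prefix_sum d i..<prefix_sum d (Suc i)}. q mod m = j} = {q}"
        using inj_onD[OF inj[OF \<open>i < n\<close>]] by blast
      then show ?thesis using True that \<open>j < m\<close> by (simp add: H)
    next
      case False
      then have "{q \<in> {prefix_sum d i..<prefix_sum d (Suc i)}. q mod m = j} = {}"
        by (auto simp: cyclic_edges_def)
      then show ?thesis using False that \<open>j < m\<close> by (simp add: H del: sum.lessThan_Suc)
    qed
    then have "(\<Sum>i<n. H $$ (i, j)) =
        (\<Sum>i<n. card {q \<in> {prefix_sum d i..<prefix_sum d (Suc i)}. q mod m = j})"
      by (intro sum.cong) auto
    then show ?thesis
      using assms(3) card_residue_class[OF \<open>j < m\<close>, of k]
      by (simp only: sum_card_consecutive)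
  qed
  then show "H \<in> multihypergraphs k n m"
    using carrier by (auto simp: multihypergraphs_iff H)
  show "degree_sequence H $ i = d i" if "i < n" for i
  proof -
    have sub: "cyclic_edges d m i \<subseteq> {..<m}" using \<open>0 < m\<close> by (auto simp: cyclic_edges_def)
    have "degree_sequence H $ i = (\<Sum>j<m. of_bool (j \<in> cyclic_edges d m i))"
      using degree_sequence_index[OF carrier that] that by (simp add: H)
    also have "\<dots> = card (cyclic_edges d m i)"
      using sub by (simp add: Int_absorb1 Collect_mem_eq sum.inter_restrict[symmetric] of_bool_def
        sum.If_cases Int_commute)
    also have "\<dots> = d i"
      using card_image[OF inj[OF that]] by (simp add: cyclic_edges_def)
    finally show ?thesis .
  qed
qed


section \<open>Dynamic programming over prefix sums\<close>

text \<open>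
  The table is stored row by row with row length \<open>w\<close>: cell \<open>i * w + s\<close> belongs to the first \<open>i\<close>
  vertices and sum \<open>s\<close>. The array \<open>V\<close> holds the best value. The array \<open>C\<close> holds 0 if the sum is
  unreachable and otherwise the successor of the degree chosen for vertex \<open>i - 1\<close>; since memory is
  initially 0, this encoding makes every cell unreachable at first. In row 0 only the sum 0 is
  reachable, and its entry 1 is a mere mark.
  
  With \<open>y = i * w + s\<close>, the cell one row below \<open>y\<close> is \<open>w + y\<close>, and giving degree \<open>u \<le> s\<close> to vertex
  \<open>i\<close> reduces it to cell \<open>y - u\<close>, which lies in the same row as \<open>y\<close>. The predicate says that cell
  \<open>w + y\<close> is optimal among the choices \<open>u < T\<close>.
\<close>

definition bellman :: "(nat \<Rightarrow> nat \<Rightarrow> real) \<Rightarrow> nat \<Rightarrow> (nat \<Rightarrow> nat) \<Rightarrow> (nat \<Rightarrow> real) \<Rightarrow> nat \<Rightarrow> nat \<Rightarrow> bool"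
  where "bellman f w C V y T \<longleftrightarrow>
    (C (w + y) = 0 \<longrightarrow> (\<forall>u<T. u \<le> y mod w \<longrightarrow> C (y - u) = 0)) \<and>
    (C (w + y) \<noteq> 0 \<longrightarrow>
      (\<exists>u<T. C (w + y) = Suc u \<and> u \<le> y mod w \<and> C (y - u) \<noteq> 0 \<and>
        V (w + y) = V (y - u) + f (y div w) u) \<and>
      (\<forall>u<T. u \<le> y mod w \<longrightarrow> C (y - u) \<noteq> 0 \<longrightarrow> V (y - u) + f (y div w) u \<le> V (w + y)))"

text \<open>
  An intermediate stage of the computation: row 0 is initialised, the next \<open>J\<close> cells are complete, and
  the first \<open>T\<close> choices have been tried for the cell after them.
\<close>

definition dp_table :: "(nat \<Rightarrow> nat \<Rightarrow> real) \<Rightarrow> nat \<Rightarrow> nat \<Rightarrow> (nat \<Rightarrow> nat) \<Rightarrow> (nat \<Rightarrow> real) \<Rightarrow> nat \<Rightarrow> nat \<Rightarrow> bool"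
  where "dp_table f w m C V J T \<longleftrightarrow>
    C 0 = 1 \<and> V 0 = 0 \<and> (\<forall>x. 0 < x \<and> x < w \<longrightarrow> C x = 0) \<and>
    (\<forall>y<J. bellman f w C V y (Suc m)) \<and> bellman f w C V J T \<and> (\<forall>x>w + J. C x = 0)"

text \<open>
  The recursion for a cell looks at no later address, so it survives the filling of later cells.
\<close>

lemma bellman_cong:
  assumes "bellman f w C V y T" "\<And>x. x \<le> w + y \<Longrightarrow> C' x = C x" "\<And>x. x \<le> w + y \<Longrightarrow> V' x = V x"
  shows "bellman f w C' V' y T"
proof -
  have "C' (w + y) = C (w + y)" "V' (w + y) = V (w + y)"
    and "C' (y - u) = C (y - u)" "V' (y - u) = V (y - u)" for u
    using assms(2,3) by simp_all
  then show ?thesis using assms(1) by (simp only: bellman_def)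
qed

lemma dp_table_next_cell:
  assumes "dp_table f w m C V J (Suc m)"
  shows "dp_table f w m C V (Suc J) 0"
proof -
  have "C (w + Suc J) = 0" using assms by (simp add: dp_table_def)
  then have "bellman f w C V (Suc J) 0" by (simp add: bellman_def)
  then show ?thesis using assms by (simp add: dp_table_def less_Suc_eq)
qed

text \<open>
  The condition under the negation is the test of the program: choice \<open>T\<close> leads to a reachable cell,
  and the current cell is either still unreachable or has a smaller value.
\<close>

lemma dp_table_keep:
  assumes "dp_table f w m C V J T"
    and keep: "\<not> (T \<le> J mod w \<and> 0 < C (J - T) \<and>
      \<not> (0 < C (w + J) \<and> \<not> V (w + J) < V (J - T) + f (J div w) T))"
  shows "dp_table f w m C V J (Suc T)"
proof -
  have T: "bellman f w C V J T" using assms by (simp add: dp_table_def)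
  have "bellman f w C V J (Suc T)"
  proof (cases "C (w + J) = 0")
    case True
    then show ?thesis using T keep unfolding bellman_def by (simp add: less_Suc_eq)
  next
    case False
    have "V (J - u) + f (J div w) u \<le> V (w + J)" if "u < Suc T" "u \<le> J mod w" "C (J - u) \<noteq> 0" for u
    proof (cases "u = T")
      case True
      then show ?thesis using that keep False by simp
    next
      case False
      then have "u < T" using that by simp
      then show ?thesis using that T \<open>C (w + J) \<noteq> 0\<close> unfolding bellman_def by blast
    qed
    moreover have "\<exists>u<Suc T. C (w + J) = Suc u \<and> u \<le> J mod w \<and> C (J - u) \<noteq> 0 \<and>
        V (w + J) = V (J - u) + f (J div w) u"
      using T False unfolding bellman_def by (meson less_SucI)
    ultimately show ?thesis using False unfolding bellman_def by blast
  qed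
  then show ?thesis using assms by (simp add: dp_table_def)
qed

lemma dp_table_update:
  assumes "dp_table f w m C V J T" "0 < w"
    and "T \<le> J mod w" "0 < C (J - T)"
    and better: "\<not> (0 < C (w + J) \<and> \<not> V (w + J) < V (J - T) + f (J div w) T)"
  shows "dp_table f w m (C(w + J := Suc T)) (V(w + J := V (J - T) + f (J div w) T)) J (Suc T)"
    (is "dp_table f w m ?C ?V J _")
proof -
  have T: "bellman f w C V J T" using assms by (simp add: dp_table_def)
  have "bellman f w ?C ?V y (Suc m)" if "y < J" for y
  proof (rule bellman_cong)
    show "bellman f w C V y (Suc m)" using assms(1) that by (simp add: dp_table_def)
  qed (use that in simp_all)
  moreover have "bellman f w ?C ?V J (Suc T)"
  proof -
    have ne: "J - u \<noteq> w + J" for u using \<open>0 < w\<close> by simp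
    have "V (J - u) + f (J div w) u \<le> V (J - T) + f (J div w) T"
      if "u < Suc T" "u \<le> J mod w" "C (J - u) \<noteq> 0" for u
    proof (cases "u = T")
      case False
      then have "u < T" using that by simp
      then have "C (w + J) \<noteq> 0" using T that unfolding bellman_def by meson
      moreover from this have "V (J - u) + f (J div w) u \<le> V (w + J)"
        using T that \<open>u < T\<close> unfolding bellman_def by meson
      ultimately show ?thesis using better by simp
    qed simp
    then show ?thesis using assms(3,4) by (auto simp: bellman_def ne)
  qed
  moreover have "\<forall>x>w + J. C x = 0" "C 0 = 1" "V 0 = 0" "\<forall>x. 0 < x \<and> x < w \<longrightarrow> C x = 0"
    using assms(1) by (simp_all add: dp_table_def)
  ultimately show ?thesis using \<open>0 < w\<close> unfolding dp_table_def by simp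
qed

lemma dp_table_row:
  assumes "dp_table f w m C V (n * w) T" "i < n" "s < w"
  shows "bellman f w C V (i * w + s) (Suc m)"
proof -
  have "Suc i * w \<le> n * w" using assms(2) by (intro mult_le_mono1) simp
  then have "i * w + s < n * w" using assms(3) by simp
  then show ?thesis using assms(1) by (auto simp: dp_table_def)
qed

text \<open>
  By induction on \<open>i\<close>: by the recursion, appending \<open>d i\<close> to a prefix never exceeds the next entry.
\<close>

lemma dp_table_upper_bound:
  assumes tab: "dp_table f w m C V (n * w) T"
    and "i \<le> n" "\<And>j. j < i \<Longrightarrow> d j \<le> m" "prefix_sum d i < w"
  shows "C (i * w + prefix_sum d i) \<noteq> 0 \<and> (\<Sum>j<i. f j (d j)) \<le> V (i * w + prefix_sum d i)"
  using assms(2-)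
proof (induction i)
  case 0
  then show ?case using tab by (simp add: dp_table_def)
next
  case (Suc i)
  let ?s = "prefix_sum d (Suc i)"
  have IH: "C (i * w + prefix_sum d i) \<noteq> 0" "(\<Sum>j<i. f j (d j)) \<le> V (i * w + prefix_sum d i)"
    using Suc by auto
  have "bellman f w C V (i * w + ?s) (Suc m)"
    using dp_table_row[OF tab, of i ?s] Suc.prems by simp
  moreover have "i * w + ?s - d i = i * w + prefix_sum d i" "d i \<le> ?s" "d i < Suc m"
    "(i * w + ?s) mod w = ?s" "(i * w + ?s) div w = i"
    using Suc.prems by (auto simp: less_Suc_eq_le)
  ultimately have "C (w + (i * w + ?s)) \<noteq> 0 \<and>
      V (i * w + prefix_sum d i) + f i (d i) \<le> V (w + (i * w + ?s))"
    using IH(1) unfolding bellman_def by metis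
  then show ?case using IH(2) by (simp add: add.assoc)
qed

text \<open>
  The recorded choices, read backwards, give the sequence. The conclusion also says that the table
  stores the degrees of this very sequence along its prefix sums, which is what the program reads.
\<close>

lemma dp_table_attained:
  assumes tab: "dp_table f w m C V (n * w) T"
    and "i \<le> n" "s < w" "C (i * w + s) \<noteq> 0"
  shows "\<exists>d. prefix_sum d i = s \<and> (\<Sum>j<i. f j (d j)) = V (i * w + s) \<and>
    (\<forall>j<i. d j \<le> m \<and> C (Suc j * w + prefix_sum d (Suc j)) = Suc (d j))"
  using assms(2-)
proof (induction i arbitrary: s)
  case 0
  then show ?case using tab by (cases "s = 0") (auto simp: dp_table_def)
next
  case (Suc i)
  have "bellman f w C V (i * w + s) (Suc m)"
    using dp_table_row[OF tab, of i s] Suc.prems by simp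
  then obtain u where u: "u \<le> m" "C (Suc i * w + s) = Suc u" "u \<le> s" "C (i * w + (s - u)) \<noteq> 0"
    "V (Suc i * w + s) = V (i * w + (s - u)) + f i u"
    using Suc.prems unfolding bellman_def by (auto simp: add.assoc less_Suc_eq_le)
  obtain d where d: "prefix_sum d i = s - u" "(\<Sum>j<i. f j (d j)) = V (i * w + (s - u))"
    "\<forall>j<i. d j \<le> m \<and> C (Suc j * w + prefix_sum d (Suc j)) = Suc (d j)"
    using Suc.IH[OF _ _ u(4)] Suc.prems less_imp_diff_less[of s w u] by (metis Suc_leD)
  let ?d = "d(i := u)"
  have same: "prefix_sum ?d j = prefix_sum d j" if "j \<le> i" for j
    using that by (intro sum.cong) auto
  have "(\<Sum>j<i. f j (?d j)) = (\<Sum>j<i. f j (d j))" by (intro sum.cong) auto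
  moreover have "?d j \<le> m \<and> C (Suc j * w + prefix_sum ?d (Suc j)) = Suc (?d j)"
    if "j < Suc i" for j
  proof (cases "j = i")
    case True
    then show ?thesis using u d(1) same[of i] by simp
  next
    case False
    then show ?thesis using that d(3) same[of "Suc j"] by (simp del: sum.lessThan_Suc)
  qed
  ultimately show ?case
    using u d(1,2) same[of i] by (intro exI[of _ ?d]) simp
qed


section \<open>The program\<close>

text \<open>
  Scalar variables: \<open>W\<close> is the row length \<open>k m + 1\<close> of the table, \<open>i\<close> the current vertex, \<open>s\<close> a
  partial sum of degrees, and \<open>h = i m\<close> the start of row \<open>i\<close> of the output. While the table is
  filled, \<open>a\<close> is the address \<open>i W + s\<close> and \<open>t\<close> the degree under trial. During the read-off, \<open>a\<close> is the
  row start \<open>i W\<close>, \<open>t\<close> counts the copies of vertex \<open>i\<close> still to be placed, and \<open>p = s mod m\<close>.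
  Before all this, \<open>i\<close> counts the additions that compute \<open>W\<close>.
\<close>

definition compute_width :: com where
  "compute_width = While (ILess (reg ''i'') (reg ''k''))
     (Seq (set_reg ''W'' (IAdd (reg ''W'') (reg ''m'')))
          (set_reg ''i'' (IAdd (reg ''i'') (IConst 1))))"

definition target_cell :: iexp where "target_cell = IAdd (reg ''W'') (reg ''a'')"

definition source_cell :: iexp where "source_cell = ISub (reg ''a'') (reg ''t'')"

definition candidate :: rexp where
  "candidate = RAdd (RLoad ''V'' source_cell) (RQuery (reg ''i'') (reg ''t''))"

definition relax :: com where
  "relax = Seq
     (Cond (BAnd (BNot (ILess (reg ''s'') (reg ''t'')))
             (BAnd (ILess (IConst 0) (ILoad ''C'' source_cell))
               (BNot (BAnd (ILess (IConst 0) (ILoad ''C'' target_cell))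
                           (BNot (RLess (RLoad ''V'' target_cell) candidate))))))
       (Seq (RStore ''V'' target_cell candidate)
            (IStore ''C'' target_cell (IAdd (reg ''t'') (IConst 1))))
       Skip)
     (set_reg ''t'' (IAdd (reg ''t'') (IConst 1)))"

definition next_cell :: com where
  "next_cell =
     Seq (set_reg ''a'' (IAdd (reg ''a'') (IConst 1)))
    (Seq (set_reg ''s'' (IAdd (reg ''s'') (IConst 1)))
    (Cond (ILess (reg ''s'') (reg ''W'')) Skip
      (Seq (set_reg ''s'' (IConst 0))
      (Seq (set_reg ''i'' (IAdd (reg ''i'') (IConst 1)))
           (set_reg ''h'' (IAdd (reg ''h'') (reg ''m'')))))))"

definition fill_table :: com where
  "fill_table = While (ILess (reg ''i'') (reg ''n''))
     (Seq (set_reg ''t'' (IConst 0))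
     (Seq (While (BNot (ILess (reg ''m'') (reg ''t''))) relax)
          next_cell))"

definition choose_degree :: com where
  "choose_degree =
     Seq (set_reg ''t'' (ISub (ILoad ''C'' (IAdd (reg ''a'') (reg ''s''))) (IConst 1)))
    (Seq (set_reg ''i'' (ISub (reg ''i'') (IConst 1)))
    (Seq (set_reg ''h'' (ISub (reg ''h'') (reg ''m'')))
         (set_reg ''a'' (ISub (reg ''a'') (reg ''W'')))))"

definition place_vertex :: com where
  "place_vertex =
     Seq (set_reg ''t'' (ISub (reg ''t'') (IConst 1)))
    (Seq (set_reg ''s'' (ISub (reg ''s'') (IConst 1)))
    (Seq (Cond (ILess (IConst 0) (reg ''p''))
           (set_reg ''p'' (ISub (reg ''p'') (IConst 1)))
           (set_reg ''p'' (ISub (reg ''m'') (IConst 1))))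
         (IStore ''H'' (IAdd (reg ''h'') (reg ''p'')) (IConst 1))))"

definition fill_matrix :: com where
  "fill_matrix = While (ILess (IConst 0) (reg ''i''))
     (Seq choose_degree (While (ILess (IConst 0) (reg ''t'')) place_vertex))"

definition program :: com where
  "program =
     Seq (set_reg ''W'' (IConst 1))
    (Seq compute_width
    (Seq (Seq (set_reg ''i'' (IConst 0)) (IStore ''C'' (IConst 0) (IConst 1)))
    (Seq fill_table
    (Seq (set_reg ''s'' (ISub (reg ''W'') (IConst 1)))
         fill_matrix))))"

definition params :: "nat \<Rightarrow> nat \<Rightarrow> nat \<Rightarrow> state \<Rightarrow> bool" where
  "params n m w s \<longleftrightarrow> imem s ''n'' 0 = n \<and> imem s ''m'' 0 = m \<and> imem s ''W'' 0 = w"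

text \<open>
  The variables \<open>h\<close>, \<open>p\<close> and the output array are included for the sake of the read-off, which starts
  with \<open>h = n m\<close>, \<open>p = k m mod m = 0\<close> and an output array of zeros.
\<close>

definition dp_state :: "(nat \<Rightarrow> nat \<Rightarrow> real) \<Rightarrow> nat \<Rightarrow> nat \<Rightarrow> nat \<Rightarrow> nat \<Rightarrow> nat \<Rightarrow> state \<Rightarrow> bool" where
  "dp_state f n m w J T s \<longleftrightarrow> params n m w s \<and>
    imem s ''i'' 0 = J div w \<and> imem s ''s'' 0 = J mod w \<and> imem s ''a'' 0 = J \<and>
    imem s ''h'' 0 = J div w * m \<and> imem s ''p'' 0 = 0 \<and> imem s ''H'' = (\<lambda>_. 0) \<and>
    dp_table f w m (imem s ''C'') (rmem s ''V'') J T"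

lemma runs_compute_width:
  fixes f k n m
  assumes "s = run f (set_reg ''W'' (IConst 1)) (input_state k n m)"
  shows "runs f compute_width s (20 * k + 10) (\<lambda>s. params n m (k * m + 1) s \<and>
    (\<forall>x \<in> {''s'', ''a'', ''h'', ''p'', ''H'', ''C''}. imem s x = (\<lambda>_. 0)) \<and> rmem s ''V'' = (\<lambda>_. 0))"
proof -
  define I where "I j s \<longleftrightarrow> params n m (j * m + 1) s \<and> imem s ''k'' 0 = k \<and> imem s ''i'' 0 = j \<and>
    (\<forall>x \<in> {''s'', ''a'', ''h'', ''p'', ''H'', ''C''}. imem s x = (\<lambda>_. 0)) \<and> rmem s ''V'' = (\<lambda>_. 0)"
    for j s
  have "I 0 s" by (simp add: I_def params_def assms input_state_def)
  \<comment> \<open>The loop test costs 5, the body 13.\<close>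
  then have "runs f compute_width s (k * (1 + 5 + 13) + (1 + 5)) (I k)"
    unfolding compute_width_def
    by (intro runs_mono[OF runs_While[where I = I and N = k and B = 13]] conjI runs_loop_free)
      (auto simp: I_def params_def)
  then show ?thesis by (rule runs_mono) (auto simp: I_def)
qed

text \<open>
  The time bound 100, here and for the other loop bodies, is a generous estimate: only its
  independence of the state matters.
\<close>

lemma runs_relax:
  assumes "dp_state f n m w J T s" "imem s ''t'' 0 = T" "0 < w"
  shows "runs f relax s 100 (\<lambda>s. dp_state f n m w J (Suc T) s \<and> imem s ''t'' 0 = Suc T)"
proof (rule runs_loop_free)
  note regs = assms[unfolded dp_state_def params_def]
  show "loop_free relax" "worst_cost relax \<le> 100"
    by (simp_all add: relax_def target_cell_def source_cell_def candidate_def)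
  show "dp_state f n m w J (Suc T) (run f relax s) \<and> imem (run f relax s) ''t'' 0 = Suc T"
  proof (cases "T \<le> J mod w \<and> 0 < imem s ''C'' (J - T) \<and> \<not> (0 < imem s ''C'' (w + J) \<and>
      \<not> rmem s ''V'' (w + J) < rmem s ''V'' (J - T) + f (J div w) T)")
    case True
    then show ?thesis
      using regs dp_table_update[of f w m "imem s ''C''" "rmem s ''V''" J T]
      by (simp add: relax_def target_cell_def source_cell_def candidate_def dp_state_def
          params_def not_less)
  next
    case False
    then show ?thesis
      using regs dp_table_keep[of f w m "imem s ''C''" "rmem s ''V''" J T]
      by (simp add: relax_def target_cell_def source_cell_def candidate_def dp_state_def
          params_def not_less) auto
  qed
qed

lemma runs_next_cell:
  assumes "dp_state f n m w J (Suc m) s" "0 < w"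
  shows "runs f next_cell s 100 (dp_state f n m w (Suc J) 0)"
proof (rule runs_loop_free)
  show "loop_free next_cell" "worst_cost next_cell \<le> 100" by (simp_all add: next_cell_def)
  have "Suc J div w = (if Suc (J mod w) < w then J div w else Suc (J div w))"
    "Suc J mod w = (if Suc (J mod w) < w then Suc (J mod w) else 0)"
    using assms(2) mod_less_divisor[OF assms(2), of J] by (auto simp: div_Suc mod_Suc)
  then show "dp_state f n m w (Suc J) 0 (run f next_cell s)"
    using assms dp_table_next_cell[of f w m _ _ J]
    by (auto simp: next_cell_def dp_state_def params_def)
qed

text \<open>
  A single loop runs through all \<open>n w\<close> cells below row 0. The row and column of a cell are the quotient
  and remainder of its number, which turns the loop test \<open>i < n\<close> into a bound on the cell number.
\<close>

lemma runs_fill_table: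
  assumes "dp_state f n m w 0 0 s" "0 < w"
  shows "runs f fill_table s (n * w * (200 * m + 400) + 100) (dp_state f n m w (n * w) 0)"
proof -
  define B where "B = 3 + ((Suc m * (1 + bcost (BNot (ILess (reg ''m'') (reg ''t''))) + 100) +
    (1 + bcost (BNot (ILess (reg ''m'') (reg ''t''))))) + 100)"
  have "runs f fill_table s (n * w * (1 + bcost (ILess (reg ''i'') (reg ''n'')) + B) +
      (1 + bcost (ILess (reg ''i'') (reg ''n'')))) (dp_state f n m w (n * w) 0)"
    unfolding fill_table_def
  proof (rule runs_While[where I = "\<lambda>J. dp_state f n m w J 0"])
    fix J s let ?L = "\<lambda>T s. dp_state f n m w J T s \<and> imem s ''t'' 0 = T"
    assume "J < n * w" and J: "dp_state f n m w J 0 s"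
    then have "J div w < n" using assms(2) by (simp add: less_mult_imp_div_less)
    moreover have "runs f (Seq (set_reg ''t'' (IConst 0))
       (Seq (While (BNot (ILess (reg ''m'') (reg ''t''))) relax) next_cell)) s B
       (dp_state f n m w (Suc J) 0)"
      unfolding B_def
    proof (rule runs_Seq)
      show "runs f (set_reg ''t'' (IConst 0)) s 3 (?L 0)"
        by (rule runs_loop_free) (use J in \<open>simp_all add: dp_state_def params_def\<close>)
    next
      fix s assume L: "?L 0 s"
      show "runs f (Seq (While (BNot (ILess (reg ''m'') (reg ''t''))) relax) next_cell) s
          ((Suc m * (1 + bcost (BNot (ILess (reg ''m'') (reg ''t''))) + 100) +
          (1 + bcost (BNot (ILess (reg ''m'') (reg ''t''))))) + 100)
          (dp_state f n m w (Suc J) 0)"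
      proof (rule runs_Seq[OF runs_While[where I = ?L]])
        show "bval f (BNot (ILess (reg ''m'') (reg ''t''))) s \<and> runs f relax s 100 (?L (Suc T))"
          if "T < Suc m" "?L T s" for T s
          using that runs_relax[of f n m w J T s] \<open>0 < w\<close> by (simp add: dp_state_def params_def)
        show "\<not> bval f (BNot (ILess (reg ''m'') (reg ''t''))) s" if "?L (Suc m) s" for s
          using that by (simp add: dp_state_def params_def)
        show "runs f next_cell s 100 (dp_state f n m w (Suc J) 0)" if "?L (Suc m) s" for s
          using that \<open>0 < w\<close> by (intro runs_next_cell) simp_all
      qed (use L in simp)
    qed
    ultimately show "bval f (ILess (reg ''i'') (reg ''n'')) s \<and> runs f (Seq (set_reg ''t'' (IConst 0))
       (Seq (While (BNot (ILess (reg ''m'') (reg ''t''))) relax) next_cell)) s B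
       (dp_state f n m w (Suc J) 0)"
      using J by (simp add: dp_state_def params_def)
  qed (use assms in \<open>auto simp: dp_state_def params_def\<close>)
  then show ?thesis
    by (rule runs_mono) (auto simp: B_def algebra_simps)
qed

text \<open>
  The contents of the output array once the positions from \<open>r\<close> upwards have been dealt out.
\<close>

definition filled :: "(nat \<Rightarrow> nat) \<Rightarrow> nat \<Rightarrow> nat \<Rightarrow> nat \<Rightarrow> nat \<Rightarrow> nat" where
  "filled d n m r x = of_bool (\<exists>i<n. \<exists>q. r \<le> q \<and> prefix_sum d i \<le> q \<and> q < prefix_sum d (Suc i) \<and>
     x = i * m + q mod m)"

lemma filled_all: "filled d n m (prefix_sum d n) = (\<lambda>_. 0)"
proof -
  have "\<not> (i < n \<and> prefix_sum d n \<le> q \<and> q < prefix_sum d (Suc i))" for i q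
    using prefix_sum_mono[of "Suc i" n d] by (auto simp del: sum.lessThan_Suc)
  then have "\<not> (\<exists>i<n. \<exists>q. prefix_sum d n \<le> q \<and> prefix_sum d i \<le> q \<and>
      q < prefix_sum d (Suc i) \<and> x = i * m + q mod m)" for x
    by blast
  then show ?thesis by (simp add: filled_def fun_eq_iff del: sum.lessThan_Suc)
qed

text \<open>
  Position \<open>r\<close> lies in the block of no other vertex, because the prefix sums are monotone.
\<close>

lemma filled_step:
  assumes "i < n" "prefix_sum d i \<le> r" "r < prefix_sum d (Suc i)"
  shows "filled d n m r = (filled d n m (Suc r))(i * m + r mod m := 1)"
proof -
  have uniq: "i' = i" if "prefix_sum d i' \<le> r" "r < prefix_sum d (Suc i')" for i'
    using that assms prefix_sum_mono[of "Suc i" i' d] prefix_sum_mono[of "Suc i'" i d]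
    by (meson Suc_leI le_less_trans less_le_not_le linorder_neqE_nat order_trans)
  have *: "(\<exists>i'<n. \<exists>q. r \<le> q \<and> prefix_sum d i' \<le> q \<and> q < prefix_sum d (Suc i') \<and>
      x = i' * m + q mod m) \<longleftrightarrow> x = i * m + r mod m \<or>
     (\<exists>i'<n. \<exists>q. Suc r \<le> q \<and> prefix_sum d i' \<le> q \<and> q < prefix_sum d (Suc i') \<and>
      x = i' * m + q mod m)" for x
    using uniq assms by (metis Suc_leD Suc_leI order_le_less)
  show ?thesis by (rule ext) (simp add: filled_def * del: sum.lessThan_Suc)
qed

text \<open>
  Division with remainder by \<open>m\<close> recovers vertex and edge from an address of the output array.
\<close>

lemma filled_index:
  assumes "i < n" "j < m"
  shows "filled d n m 0 (i * m + j) = of_bool (j \<in> cyclic_edges d m i)"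
proof -
  have eq: "i = i' \<and> j = q mod m" if "i * m + j = i' * m + q mod m" for i' q
  proof -
    have "q mod m < m" using assms by simp
    then show ?thesis
      using arg_cong[OF that, of "\<lambda>x. x div m"] arg_cong[OF that, of "\<lambda>x. x mod m"] assms by simp
  qed
  have "(\<exists>i'<n. \<exists>q. 0 \<le> q \<and> prefix_sum d i' \<le> q \<and> q < prefix_sum d (Suc i') \<and>
      i * m + j = i' * m + q mod m) \<longleftrightarrow>
    (\<exists>q. prefix_sum d i \<le> q \<and> q < prefix_sum d (Suc i) \<and> j = q mod m)"
    using eq assms(1) by blast
  also have "\<dots> \<longleftrightarrow> j \<in> cyclic_edges d m i"
    by (auto simp: cyclic_edges_def simp del: sum.lessThan_Suc)
  finally show ?thesis by (simp only: filled_def)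
qed

definition fill_state ::
  "(nat \<Rightarrow> nat) \<Rightarrow> (nat \<Rightarrow> nat) \<Rightarrow> nat \<Rightarrow> nat \<Rightarrow> nat \<Rightarrow> nat \<Rightarrow> nat \<Rightarrow> state \<Rightarrow> bool" where
  "fill_state C d n m w i r s \<longleftrightarrow> params n m w s \<and>
    imem s ''C'' = C \<and> imem s ''i'' 0 = i \<and> imem s ''h'' 0 = i * m \<and> imem s ''a'' 0 = i * w \<and>
    imem s ''s'' 0 = r \<and> imem s ''p'' 0 = r mod m \<and> imem s ''H'' = filled d n m r"

lemma runs_choose_degree:
  assumes "fill_state C d n m w (Suc i) (prefix_sum d (Suc i)) s"
    and "C (Suc i * w + prefix_sum d (Suc i)) = Suc (d i)"
  shows "runs f choose_degree s 100
    (\<lambda>s. fill_state C d n m w i (prefix_sum d (Suc i)) s \<and> imem s ''t'' 0 = d i)"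
  by (rule runs_loop_free)
    (use assms in \<open>simp_all add: choose_degree_def fill_state_def params_def del: sum.lessThan_Suc\<close>)

text \<open>
  The cyclic decrement of \<open>p\<close> keeps it equal to the position modulo \<open>m\<close>.
\<close>

lemma runs_place_vertex:
  assumes "fill_state C d n m w i (Suc r) s" "imem s ''t'' 0 = Suc t"
    and "i < n" "prefix_sum d i \<le> r" "r < prefix_sum d (Suc i)" "0 < m"
  shows "runs f place_vertex s 100 (\<lambda>s. fill_state C d n m w i r s \<and> imem s ''t'' 0 = t)"
proof (rule runs_loop_free)
  have "r mod m = (if 0 < Suc r mod m then Suc r mod m - 1 else m - 1)"
    using \<open>0 < m\<close> by (auto simp: mod_Suc)
  then show "fill_state C d n m w i r (run f place_vertex s) \<and> imem (run f place_vertex s) ''t'' 0 = t"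
    using assms filled_step[OF assms(3-5)]
    by (auto simp: place_vertex_def fill_state_def params_def simp del: sum.lessThan_Suc)
qed (simp_all add: place_vertex_def)

text \<open>
  Vertices are treated in descending order: after \<open>J\<close> rounds the positions from
  \<open>prefix_sum d (n - J)\<close> upwards are filled, and the table entry read next gives \<open>d (n - J - 1)\<close>.
\<close>

lemma runs_fill_matrix:
  assumes "fill_state C d n m w n (prefix_sum d n) s" "0 < m"
    and d: "\<And>i. i < n \<Longrightarrow> d i \<le> m"
    and C: "\<And>i. i < n \<Longrightarrow> C (Suc i * w + prefix_sum d (Suc i)) = Suc (d i)"
  shows "runs f fill_matrix s (n * (200 * m + 300) + 100) (fill_state C d n m w 0 0)"
proof -
  define B where "B = 100 + (m * (1 + 4 + 100) + (1 + 4))"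
  let ?I = "\<lambda>J. fill_state C d n m w (n - J) (prefix_sum d (n - J))"
  have "runs f fill_matrix s
      (n * (1 + bcost (ILess (IConst 0) (reg ''i'')) + B) + (1 + bcost (ILess (IConst 0) (reg ''i'')))) (?I n)"
    unfolding fill_matrix_def
  proof (rule runs_While[where I = ?I and B = B])
    fix J s assume "J < n" and J: "?I J s"
    define i where "i = n - Suc J"
    have i: "n - J = Suc i" "i < n" using \<open>J < n\<close> by (auto simp: i_def)
    let ?L = "\<lambda>T s. fill_state C d n m w i (prefix_sum d (Suc i) - T) s \<and> imem s ''t'' 0 = d i - T"
    have "runs f (Seq choose_degree (While (ILess (IConst 0) (reg ''t'')) place_vertex)) s B
        (?I (Suc J))"
      unfolding B_def
    proof (rule runs_Seq[OF runs_choose_degree[OF J[unfolded i] C[OF i(2)]]])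
      fix s assume s: "fill_state C d n m w i (prefix_sum d (Suc i)) s \<and> imem s ''t'' 0 = d i"
      show "runs f (While (ILess (IConst 0) (reg ''t'')) place_vertex) s (m * (1 + 4 + 100) + (1 + 4))
        (?I (Suc J))"
      proof (rule runs_mono[OF runs_While[where I = ?L and N = "d i" and B = 100]])
        fix T s assume T: "T < d i" and L: "?L T s"
        have "runs f place_vertex s 100 (?L (Suc T))"
        proof (rule runs_place_vertex)
          have "Suc (prefix_sum d (Suc i) - Suc T) = prefix_sum d (Suc i) - T"
            using T by simp
          then show "fill_state C d n m w i (Suc (prefix_sum d (Suc i) - Suc T)) s"
            using L by (simp del: sum.lessThan_Suc)
        qed (use T L i assms(2) in auto)
        then show "bval f (ILess (IConst 0) (reg ''t'')) s \<and> runs f place_vertex s 100 (?L (Suc T))"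
          using L T by simp
      next
        show "d i * (1 + bcost (ILess (IConst 0) (reg ''t'')) + 100) +
            (1 + bcost (ILess (IConst 0) (reg ''t''))) \<le> m * (1 + 4 + 100) + (1 + 4)"
          using d[OF i(2)] by simp
      qed (use s in \<open>auto simp: i_def[symmetric]\<close>)
    qed
    then show "bval f (ILess (IConst 0) (reg ''i'')) s \<and>
        runs f (Seq choose_degree (While (ILess (IConst 0) (reg ''t'')) place_vertex)) s B (?I (Suc J))"
      using J i by (simp add: fill_state_def)
  qed (use assms in \<open>auto simp: fill_state_def add.assoc simp del: sum.lessThan_Suc\<close>)
  then show ?thesis
    by (rule runs_mono) (auto simp: B_def algebra_simps)
qed

text \<open>
  Optimality of the output: any competitor's degree sequence is admissible, so its objective is at
  most the table entry for all \<open>n\<close> vertices and sum \<open>k m\<close>, which the traced sequence attains.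
\<close>

lemma runs_read_off:
  assumes dp: "dp_state f n m w (n * w) 0 s" and w: "w = k * m + 1" and "0 < m" "k \<le> n"
  shows "runs f (Seq (set_reg ''s'' (ISub (reg ''W'') (IConst 1))) fill_matrix) s
      (10 + (n * (200 * m + 300) + 100))
    (\<lambda>s. output_matrix n m s \<in> multihypergraphs k n m \<and>
      (\<forall>G \<in> multihypergraphs k n m. objective n f G \<le> objective n f (output_matrix n m s)))"
    (is "runs f _ _ _ ?optimal")
proof -
  let ?C = "imem s ''C''" and ?V = "rmem s ''V''"
  have tab: "dp_table f w m ?C ?V (n * w) 0" using dp by (simp add: dp_state_def)
  have bound: "?C (n * w + k * m) \<noteq> 0" "(\<Sum>i<n. f i (d i)) \<le> ?V (n * w + k * m)"
    if "\<And>i. i < n \<Longrightarrow> d i \<le> m" "prefix_sum d n = k * m" for d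
    using dp_table_upper_bound[OF tab order_refl, of d] that w by auto
  \<comment> \<open>The sum \<open>k m\<close> is reachable: put the same \<open>k\<close> vertices into all edges.\<close>
  have "prefix_sum (\<lambda>i. if i < k then m else 0) n = k * m"
  proof -
    have "{..<n} \<inter> {i. i < k} = {..<k}" using \<open>k \<le> n\<close> by auto
    then show ?thesis by (simp add: sum.If_cases)
  qed
  then have "?C (n * w + k * m) \<noteq> 0" using bound(1)[of "\<lambda>i. if i < k then m else 0"] by simp
  then obtain d where d: "prefix_sum d n = k * m" "(\<Sum>j<n. f j (d j)) = ?V (n * w + k * m)"
    "\<And>j. j < n \<Longrightarrow> d j \<le> m" "\<And>j. j < n \<Longrightarrow> ?C (Suc j * w + prefix_sum d (Suc j)) = Suc (d j)"
    using dp_table_attained[OF tab order_refl, of "k * m"] w by auto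
  let ?s = "run f (set_reg ''s'' (ISub (reg ''W'') (IConst 1))) s"
  have fill: "fill_state ?C d n m w n (prefix_sum d n) ?s"
    using dp d(1) filled_all[of d n m] w by (simp add: dp_state_def fill_state_def params_def del: mult_Suc_right)
  show ?thesis
  proof (rule runs_Seq[OF runs_loop_free[where Q = "\<lambda>s. s = ?s"]])
    fix s assume s: "s = ?s"
    show "runs f fill_matrix s (n * (200 * m + 300) + 100) ?optimal"
      unfolding s
    proof (rule runs_mono[OF runs_fill_matrix[OF fill \<open>0 < m\<close> d(3,4)] order_refl])
      fix s assume s: "fill_state ?C d n m w 0 0 s"
      have "output_matrix n m s = mat n m (\<lambda>(i, j). of_bool (j \<in> cyclic_edges d m i))"
        unfolding output_matrix_def using s by (intro cong_mat) (auto simp: fill_state_def filled_index)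
      note H = cyclic_matrix[OF \<open>0 < m\<close> d(3) d(1) this]
      have "objective n f G \<le> objective n f (output_matrix n m s)" if "G \<in> multihypergraphs k n m" for G
        using bound(2)[of "\<lambda>i. degree_sequence G $ i"] degree_le[OF that] sum_degrees[OF that] d(2) H(2)
        by (simp add: objective_def)
      with H(1) show "?optimal s" by blast
    qed
  qed simp_all
qed

text \<open>
  The time bound is kept as the nested sum that sequential composition produces.
\<close>

lemma runs_program:
  assumes "0 < m" "k \<le> n"
  shows "runs f program (input_state k n m) (10 + ((20 * k + 10) + (10 +
      ((n * (k * m + 1) * (200 * m + 400) + 100) + (10 + (n * (200 * m + 300) + 100))))))
    (\<lambda>s. output_matrix n m s \<in> multihypergraphs k n m \<and>
      (\<forall>G \<in> multihypergraphs k n m. objective n f G \<le> objective n f (output_matrix n m s)))"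
    (is "runs f _ _ _ ?optimal")
proof -
  define w where "w = k * m + 1"
  let ?s = "run f (set_reg ''W'' (IConst 1)) (input_state k n m)"
  show ?thesis
    unfolding program_def w_def[symmetric]
  proof (rule runs_Seq, rule_tac [2] runs_Seq, rule_tac [3] runs_Seq, rule_tac [4] runs_Seq)
    show "runs f (set_reg ''W'' (IConst 1)) (input_state k n m) 10 (\<lambda>s. s = ?s)"
      by (rule runs_loop_free) simp_all
    show "runs f compute_width s (20 * k + 10) (\<lambda>s. params n m w s \<and>
        (\<forall>x \<in> {''s'', ''a'', ''h'', ''p'', ''H'', ''C''}. imem s x = (\<lambda>_. 0)) \<and> rmem s ''V'' = (\<lambda>_. 0))"
      if "s = ?s" for s
      unfolding w_def using that by (rule runs_compute_width)
    show "runs f (Seq (set_reg ''i'' (IConst 0)) (IStore ''C'' (IConst 0) (IConst 1))) s 10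
        (dp_state f n m w 0 0)" if "params n m w s \<and>
        (\<forall>x \<in> {''s'', ''a'', ''h'', ''p'', ''H'', ''C''}. imem s x = (\<lambda>_. 0)) \<and> rmem s ''V'' = (\<lambda>_. 0)" for s
      by (rule runs_loop_free)
        (use that in \<open>auto simp: w_def dp_state_def params_def dp_table_def bellman_def\<close>)
    show "runs f fill_table s (n * w * (200 * m + 400) + 100) (dp_state f n m w (n * w) 0)"
      if "dp_state f n m w 0 0 s" for s
      using that by (rule runs_fill_table) (simp add: w_def)
    show "runs f (Seq (set_reg ''s'' (ISub (reg ''W'') (IConst 1))) fill_matrix) s
        (10 + (n * (200 * m + 300) + 100)) ?optimal" if "dp_state f n m w (n * w) 0 s" for s
      using that w_def assms by (rule runs_read_off)
  qed
qed

theorem theorem1p1: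
  shows "\<exists>(P :: com) (p :: nat poly poly poly).
    \<forall>(k::nat) (n::nat) (m::nat) (f :: nat \<Rightarrow> nat \<Rightarrow> real).
      0 < k \<and> 0 < n \<and> 0 < m \<and> k \<le> n \<longrightarrow>
      (\<exists>t s. exec f P (input_state k n m) t s \<and> t \<le> poly3 p k n m \<and>
        output_matrix n m s \<in> multihypergraphs k n m \<and>
        (\<forall>G \<in> multihypergraphs k n m. objective n f G \<le> objective n f (output_matrix n m s)))"
proof -
  \<comment> \<open>The three indeterminates: \<open>poly3\<close> substitutes \<open>k\<close> for the outermost one and \<open>m\<close> for the innermost.\<close>
  define K N M :: "nat poly poly poly"
    where "K = [:0, 1:]" and "N = [:[:0, 1:]:]" and "M = [:[:[:0, 1:]:]:]"
  define p where "p = (10 + ((20 * K + 10) + (10 +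
      ((N * (K * M + 1) * (200 * M + 400) + 100) + (10 + (N * (200 * M + 300) + 100))))))"
  have "poly3 p k n m = (10 + ((20 * k + 10) + (10 +
      ((n * (k * m + 1) * (200 * m + 400) + 100) + (10 + (n * (200 * m + 300) + 100))))))" for k n m
    by (simp add: p_def K_def N_def M_def poly3_def poly_numeral algebra_simps)
  then show ?thesis
    using runs_program unfolding runs_def by (intro exI[of _ program] exI[of _ p]) metis
qed

end
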